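(* Let $(\mathcal{X},d)$ be a complete, separable, non-compact, locally compact length space and let $p>1$. Then every $\nu\in P_p(\mathcal{X})$ is the origin of at least one unit-speed ray in $(P_p(\mathcal{X}),W_p)$, i.e. there is a unit-speed ray $(\nu_t)_{t\ge 0}$ in $P_p(\mathcal{X})$ with $\nu_0=\nu$.
   Context: $P_p(\mathcal{X})$ is the set of Borel probability measures $\mu$ on $\mathcal{X}$ with $\int_{\mathcal{X}} d(x_0,x)^p\,d\mu(x)<\infty$ for some (equivalently every) $x_0\in\mathcal{X}$, equipped with the Wasserstein distance $W_p(\mu,\nu)=\big(\min_{\pi\in\Pi(\mu,\nu)}\int_{\mathcal{X}\times\mathcal{X}} d(x,y)^p\,d\pi(x,y)\big)^{1/p}$, where $\Pi(\mu,\nu)$ is the set of Borel probability measures on $\mathcal{X}\times\mathcal{X}$ with marginals $\mu$ and $\nu$. In a metric space $(\mathcal{Y},d)$, a ray is a continuous curve $\gamma:[0,\infty)\to\mathcal{Y}$ with $d(\gamma_s,\gamma_t)=|s-t|\,d(\gamma_0,\gamma_1)$ for all $s,t\ge 0$; its speed is $d(\gamma_0,\gamma_1)$, and it is unit-speed if the speed is $1$. *)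

theory Defs
  imports "HOL-Analysis.Analysis" "HOL-Probability.Probability"
begin

definition curve_length :: "(real \<Rightarrow> 'a::metric_space) \<Rightarrow> real \<Rightarrow> real \<Rightarrow> ereal" where
  "curve_length g a b =
     (SUP (n, t) \<in> {(n, t). t 0 = a \<and> t n = b \<and> (\<forall>i<n. t i \<le> t (Suc i))}.
        ereal (\<Sum>i<n. dist (g (t i)) (g (t (Suc i)))))"

definition length_space :: "'a::metric_space itself \<Rightarrow> bool" where
  "length_space _ \<longleftrightarrow>
     (\<forall>x y::'a. ereal (dist x y) =
        (INF g \<in> {g. continuous_on {0..1} g \<and> g 0 = x \<and> g 1 = y}. curve_length g 0 1))"

definition Pp :: "real \<Rightarrow> 'a::metric_space measure set" where
  "Pp p = {\<mu>. sets \<mu> = sets borel \<and> prob_space \<mu> \<and>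
              (\<exists>x0. (\<integral>\<^sup>+ x. ennreal (dist x0 x powr p) \<partial>\<mu>) < \<infinity>)}"

definition couplings :: "'a::metric_space measure \<Rightarrow> 'a measure \<Rightarrow> ('a \<times> 'a) measure set" where
  "couplings \<mu> \<nu> = {\<pi>. sets \<pi> = sets borel \<and> prob_space \<pi> \<and>
                       distr \<pi> borel fst = \<mu> \<and> distr \<pi> borel snd = \<nu>}"

(* p-Wasserstein distance (the infimum is attained, so this is the min of the paper) *)
definition Wp :: "real \<Rightarrow> 'a::metric_space measure \<Rightarrow> 'a measure \<Rightarrow> real" where
  "Wp p \<mu> \<nu> = enn2real (INF \<pi> \<in> couplings \<mu> \<nu>.
                  \<integral>\<^sup>+ z. ennreal (dist (fst z) (snd z) powr p) \<partial>\<pi>) powr (1 / p)"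

definition Wp_ray :: "real \<Rightarrow> (real \<Rightarrow> 'a::metric_space measure) \<Rightarrow> bool" where
  "Wp_ray p \<gamma> \<longleftrightarrow>
     (\<forall>t\<ge>0. \<gamma> t \<in> Pp p) \<and>
     (\<forall>t\<ge>0. \<forall>e>0. \<exists>\<delta>>0. \<forall>s\<ge>0. \<bar>s - t\<bar> < \<delta> \<longrightarrow> Wp p (\<gamma> s) (\<gamma> t) < e) \<and>
     (\<forall>s\<ge>0. \<forall>t\<ge>0. Wp p (\<gamma> s) (\<gamma> t) = \<bar>s - t\<bar> * Wp p (\<gamma> 0) (\<gamma> 1))"

end

theory Submission
  imports Defs
begin

text \<open>By the Hopf--Rinow theorem the space is proper and geodesic, and it is unbounded. A limit \<open>b\<close>
  of the functions \<open>d(y, x\<^sub>n) - d(o, x\<^sub>n)\<close> with \<open>x\<^sub>n\<close> tending to infinity is 1-Lipschitz, and from every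
  point \<open>y\<close> one can move by distance 1 so that \<open>b\<close> drops by exactly 1. Borel selections of such a step
  and of midpoints, iterated on dyadic times, give a Borel family of unit-speed rays \<open>\<Gamma> t y\<close> from \<open>y\<close>
  with \<open>b (\<Gamma> t y) = b y - t\<close>. Push \<open>\<nu>\<close> forward by \<open>\<Gamma> t\<close>: moving mass along the rays costs at most
  \<open>\<bar>s - t\<bar>\<^sup>p\<close>, and since the mean of \<open>b\<close> changes by \<open>\<bar>s - t\<bar>\<close>, no coupling is cheaper.\<close>


section \<open>Length spaces: the Hopf--Rinow theorem and intermediate points\<close>

text \<open>An almost shortest curve from \<open>x\<close> to \<open>y\<close> crosses the sphere of
  radius \<open>r\<close> around \<open>x\<close> by the intermediate value theorem. The partition
  0, \<open>s\<close>, 1 then bounds its length below by the sum of the two distances.\<close>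

lemma length_space_approx_between:
  fixes x y :: "'a::metric_space"
  assumes "length_space TYPE('a)" and "0 \<le> r" "r \<le> dist x y" "0 < e"
  obtains z where "dist x z = r" "dist z y < dist x y - r + e"
proof -
  have "(INF g \<in> {g. continuous_on {0..1} g \<and> g 0 = x \<and> g 1 = y}. curve_length g 0 1)
      < ereal (dist x y + e)"
    using assms unfolding length_space_def by (metis ereal_less(2) ereal_less_eq(3) less_add_same_cancel1 less_ereal.simps(1))
  then obtain g where g: "continuous_on {0..1} g" "g 0 = x" "g 1 = y"
    and len: "curve_length g 0 1 < ereal (dist x y + e)"
    by (auto simp: INF_less_iff)
  have "continuous_on {0..1} (\<lambda>s. dist x (g s))"
    using g(1) by (intro continuous_intros)
  moreover have "dist x (g 0) \<le> r" "r \<le> dist x (g 1)" using g assms by auto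
  ultimately obtain s where s: "0 \<le> s" "s \<le> 1" "dist x (g s) = r"
    using IVT'[of "\<lambda>s. dist x (g s)" 0 r 1] by auto
  define t :: "nat \<Rightarrow> real" where "t = (\<lambda>i. if i = 0 then 0 else if i = 1 then s else 1)"
  have "(2, t) \<in> {(n, t). t 0 = 0 \<and> t n = 1 \<and> (\<forall>i<n. t i \<le> t (Suc i))}"
    using s by (auto simp: t_def less_Suc_eq numeral_2_eq_2)
  then have "ereal (\<Sum>i<2. dist (g (t i)) (g (t (Suc i)))) \<le> curve_length g 0 1"
    unfolding curve_length_def by (rule SUP_upper2) auto
  moreover have "(\<Sum>i<2. dist (g (t i)) (g (t (Suc i)))) = r + dist (g s) y"
    using g s by (simp add: t_def numeral_2_eq_2)
  ultimately have "ereal (r + dist (g s) y) < ereal (dist x y + e)"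
    using len by (metis le_less_trans)
  then show ?thesis using that[OF s(3)] by simp
qed

text \<open>By completeness only total boundedness is at stake. Every point of the ball of radius
  \<open>R\<close> is within \<open>2 * \<delta>\<close> of the compact ball of radius
  \<open>R - \<delta>\<close>, so a finite \<open>e/4\<close>-net of the latter is an
  \<open>e\<close>-net of the former.\<close>

lemma complete_length_space_cball_limit:
  fixes x :: "'a::complete_space"
  assumes ls: "length_space TYPE('a)" and "0 < R"
    and c: "\<And>r. 0 \<le> r \<Longrightarrow> r < R \<Longrightarrow> compact (cball x r)"
  shows "compact (cball x R)"
  unfolding compact_eq_totally_bounded
proof (intro conjI allI impI)
  show "Topological_Spaces.complete (cball x R)" by (simp add: complete_eq_closed)
  fix e :: real assume "0 < e"
  \<comment> \<open>The bound \<open>e/4\<close> gives \<open>e/4 + 2 * \<delta> < e\<close> up to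
    strictness of the net; the bound \<open>R/2\<close> keeps \<open>R - \<delta>\<close> positive
    and below \<open>R\<close>.\<close>
  define \<delta> where "\<delta> = min (e/4) (R/2)"
  have \<delta>: "0 < \<delta>" "\<delta> < R" "\<delta> \<le> e/4" using \<open>0 < e\<close> \<open>0 < R\<close> by (auto simp: \<delta>_def)
  have "compact (cball x (R - \<delta>))" using \<delta> by (intro c) auto
  then obtain k where k: "finite k" "cball x (R - \<delta>) \<subseteq> (\<Union>z\<in>k. ball z (e/4))"
    unfolding compact_eq_totally_bounded using \<open>0 < e\<close> by (metis divide_pos_pos zero_less_numeral)
  have "cball x R \<subseteq> (\<Union>z\<in>k. ball z e)"
  proof
    fix y assume "y \<in> cball x R"
    define r where "r = min (R - \<delta>) (dist x y)"
    obtain z where z: "dist x z = r" "dist z y < dist x y - r + \<delta>"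
      using length_space_approx_between[OF ls, of r x y \<delta>] \<delta> by (auto simp: r_def)
    have "z \<in> cball x (R - \<delta>)" using z by (auto simp: r_def)
    then obtain w where w: "w \<in> k" "dist w z < e/4" using k by (auto simp: mem_ball)
    have "dist z y < 2 * \<delta>" using z \<open>y \<in> cball x R\<close> \<delta> by (auto simp: r_def min_def split: if_splits)
    then have "dist w y < e" using w \<delta> dist_triangle[of w y z] by simp
    then show "y \<in> (\<Union>z\<in>k. ball z e)" using w by auto
  qed
  then show "\<exists>k. finite k \<and> cball x R \<subseteq> (\<Union>z\<in>k. ball z e)" using k by blast
qed

text \<open>Finitely many open sets with compact enclosures cover the ball and hence also its
  \<open>e\<close>-neighbourhood. In a length space this neighbourhood contains the ball of radius
  \<open>R + e/2\<close>.\<close>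

lemma locally_compact_length_space_cball_extend:
  fixes x :: "'a::metric_space"
  assumes ls: "length_space TYPE('a)" and lc: "locally_compact_space (euclidean :: 'a topology)"
    and "0 \<le> R" and K: "compact (cball x R)"
  obtains e where "0 < e" "compact (cball x (R + e))"
proof -
  have "\<exists>U K. open U \<and> compact K \<and> y \<in> U \<and> U \<subseteq> K" for y :: 'a
    using lc unfolding locally_compact_space_def by simp
  then obtain U V where UV: "\<And>y::'a. open (U y)" "\<And>y. compact (V y)" "\<And>y. y \<in> U y" "\<And>y. U y \<subseteq> V y"
    by metis
  have "cball x R \<subseteq> (\<Union>y\<in>cball x R. U y)" using UV(3) by blast
  then obtain F where F: "finite F" "cball x R \<subseteq> (\<Union>y\<in>F. U y)"
    by (rule compactE_image[OF K UV(1)]) auto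
  obtain e where e: "0 < e" "(\<Union>z\<in>cball x R. ball z e) \<subseteq> (\<Union>y\<in>F. U y)"
    by (rule compact_subset_open_imp_ball_epsilon_subset[OF K _ F(2)]) (use UV(1) in auto)
  have "cball x (R + e/2) \<subseteq> (\<Union>y\<in>F. V y)"
  proof
    fix y assume y: "y \<in> cball x (R + e/2)"
    define r where "r = min R (dist x y)"
    obtain z where z: "dist x z = r" "dist z y < dist x y - r + e/2"
      using length_space_approx_between[OF ls, of r x y "e/2"] e \<open>0 \<le> R\<close> by (auto simp: r_def)
    then have "z \<in> cball x R" "y \<in> ball z e" using y e(1) by (auto simp: r_def min_def split: if_splits)
    then have "y \<in> (\<Union>y\<in>F. U y)" using e(2) by blast
    then show "y \<in> (\<Union>y\<in>F. V y)" using UV(4) by blast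
  qed
  moreover have "compact (\<Union>y\<in>F. V y)" using F UV by blast
  ultimately have "compact (cball x (R + e/2))"
    by (metis closed_cball compact_Int_closed inf.absorb_iff2)
  then show ?thesis using that[of "e/2"] e by auto
qed

text \<open>If some ball is not compact, the radii of compact balls around \<open>x\<close> are
  bounded. Their supremum \<open>R\<close> again has a compact ball, by total boundedness, and a
  slightly larger radius still has one, a contradiction.\<close>

theorem Hopf_Rinow_compact_cball:
  fixes x :: "'a::complete_space"
  assumes ls: "length_space TYPE('a)" and lc: "locally_compact_space (euclidean :: 'a topology)"
  shows "compact (cball x r)"
proof (rule ccontr)
  assume nc: "\<not> compact (cball x r)"
  define A where "A = {s. 0 \<le> s \<and> compact (cball x s)}"
  have mono: "compact (cball x s)" if "compact (cball x t)" "s \<le> t" for s t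
    using that by (metis closed_cball compact_Int_closed inf.absorb_iff2 subset_cball)
  have bdd: "s \<le> r" if "s \<in> A" for s
    using nc mono[of s r] that by (force simp: A_def)
  have "0 \<in> A" by (simp add: A_def)
  define R where "R = Sup A"
  have A_le: "s \<le> R" if "s \<in> A" for s
    unfolding R_def using that bdd by (meson bdd_aboveI cSup_upper)
  have "0 \<le> R" using A_le \<open>0 \<in> A\<close> by auto
  have "compact (cball x R)"
  proof (cases "R = 0")
    case False
    show ?thesis
    proof (rule complete_length_space_cball_limit[OF ls])
      show "0 < R" using False \<open>0 \<le> R\<close> by simp
      fix s assume "s < R"
      then have "s < Sup A" by (simp add: R_def)
      then obtain t where "t \<in> A" "s < t"
        by (rule less_cSupE) (use \<open>0 \<in> A\<close> in auto)
      then show "compact (cball x s)" using mono[of t s] by (simp add: A_def)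
    qed
  qed simp
  then obtain e where "0 < e" "compact (cball x (R + e))"
    using locally_compact_length_space_cball_extend[OF ls lc \<open>0 \<le> R\<close>] by metis
  then show False using A_le[of "R + e"] \<open>0 \<le> R\<close> by (simp add: A_def)
qed

text \<open>Almost intermediate points all lie in a compact ball; a limit point of them is exactly
  intermediate.\<close>

lemma proper_length_space_between:
  fixes x y :: "'a::metric_space"
  assumes ls: "length_space TYPE('a)" and proper: "\<And>(x::'a::metric_space) r. compact (cball x r)"
    and "0 \<le> r" "r \<le> dist x y"
  obtains z where "dist x z = r" "dist z y = dist x y - r"
proof -
  have "\<exists>z. dist x z = r \<and> dist z y < dist x y - r + inverse (real (Suc n))" for n
    using length_space_approx_between[OF ls assms(3,4), of "inverse (real (Suc n))"]
    by (metis inverse_positive_iff_positive of_nat_0_less_iff zero_less_Suc)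
  then obtain z where z: "\<And>n. dist x (z n) = r"
    "\<And>n. dist (z n) y < dist x y - r + inverse (real (Suc n))" by metis
  have "z n \<in> cball x r" for n using z by simp
  then obtain l \<sigma> where l: "strict_mono (\<sigma> :: nat \<Rightarrow> nat)" "(z \<circ> \<sigma>) \<longlonglongrightarrow> l"
    using proper[of x r] unfolding compact_def by blast
  have "(\<lambda>n. dist x ((z \<circ> \<sigma>) n)) \<longlonglongrightarrow> dist x l" by (intro tendsto_intros l)
  then have 1: "dist x l = r" using z by (simp add: LIMSEQ_const_iff)
  have "(\<lambda>n. dist x y - r + (inverse \<circ> (\<lambda>n. real (Suc n)) \<circ> \<sigma>) n) \<longlonglongrightarrow> dist x y - r + 0"
    by (intro tendsto_intros LIMSEQ_subseq_LIMSEQ[OF _ l(1)])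
       (use LIMSEQ_inverse_real_of_nat in \<open>simp add: o_def\<close>)
  then have upper: "(\<lambda>n. dist x y - r + (inverse \<circ> (\<lambda>n. real (Suc n)) \<circ> \<sigma>) n) \<longlonglongrightarrow> dist x y - r"
    by simp
  have "(\<lambda>n. dist ((z \<circ> \<sigma>) n) y) \<longlonglongrightarrow> dist l y" by (intro tendsto_intros l)
  then have "dist l y \<le> dist x y - r"
  proof (rule LIMSEQ_le[OF _ upper])
    show "\<exists>N. \<forall>n\<ge>N. dist ((z \<circ> \<sigma>) n) y
        \<le> dist x y - r + (inverse \<circ> (\<lambda>n. real (Suc n)) \<circ> \<sigma>) n"
      using less_imp_le[OF z(2)] unfolding o_def by blast
  qed
  then show ?thesis using that[OF 1] 1 dist_triangle[of x y l] by simp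
qed

section \<open>Horofunctions\<close>

text \<open>The \<open>liminf\<close> makes a subsequence depending on \<open>y\<close> sufficient, so that no
  Arzela--Ascoli argument is needed.\<close>

lemma horofunction_exists:
  assumes ls: "length_space TYPE('a::metric_space)"
    and proper: "\<And>(x::'a::metric_space) r. compact (cball x r)" and nc: "\<not> compact (UNIV :: 'a::metric_space set)"
  obtains b :: "'a::metric_space \<Rightarrow> real" where "\<And>x y. \<bar>b x - b y\<bar> \<le> dist x y"
    "\<And>y. \<exists>z. dist y z = 1 \<and> b z = b y - 1"
proof -
  fix o' :: 'a
  have "\<exists>x. real n < dist o' x" for n
  proof (rule ccontr)
    assume "\<not> ?thesis"
    then have "cball o' (real n) = UNIV" by (auto simp: not_less)
    then show False using proper nc by metis
  qed
  then obtain x where x: "\<And>n. real n < dist o' (x n)" by metis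
  define B where "B n y = dist y (x n) - dist o' (x n)" for n y
  define L where "L y = liminf (\<lambda>n. ereal (B n y))" for y
  define b where "b y = real_of_ereal (L y)" for y
  have lip: "B n y \<le> B n z + dist y z" for n y z
    unfolding B_def using dist_triangle[of y "x n" z] by simp
  \<comment> \<open>Each \<open>B n\<close> vanishes at \<open>o'\<close> and is 1-Lipschitz, so the
    \<open>liminf\<close> is finite and \<open>real_of_ereal\<close> loses nothing in the definition
    of \<open>b\<close>.\<close>
  have "\<bar>L y\<bar> \<noteq> \<infinity>" for y
  proof -
    have *: "\<bar>B n y\<bar> \<le> dist y o'" for n
      using lip[of n y o'] lip[of n o' y] by (simp add: B_def dist_commute)
    have "ereal (- dist y o') \<le> L y" unfolding L_def
      by (intro Liminf_bounded always_eventually) (use * in \<open>auto simp: abs_le_iff minus_le_iff\<close>)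
    moreover have "L y \<le> ereal (dist y o')"
    proof -
      have "L y \<le> limsup (\<lambda>n. ereal (B n y))" unfolding L_def by (simp add: Liminf_le_Limsup)
      also have "\<dots> \<le> ereal (dist y o')"
        by (intro Limsup_bounded always_eventually) (use * in \<open>auto simp: abs_le_iff\<close>)
      finally show ?thesis .
    qed
    ultimately show ?thesis by auto
  qed
  then have L: "L y = ereal (b y)" for y by (simp add: b_def ereal_real)
  have sub: "\<exists>r. strict_mono r \<and> (\<lambda>n. B (r n) y) \<longlonglongrightarrow> b y" for y
    using liminf_subseq_lim[of "\<lambda>n. ereal (B n y)"] L[of y] by (auto simp: L_def o_def)
  \<comment> \<open>Passing to a subsequence can only raise a \<open>liminf\<close>, so upper bounds
    on \<open>b\<close> may be checked along one subsequence, and only from some index on.\<close>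
  have le: "b y \<le> c" if "strict_mono r" "\<And>n. N \<le> n \<Longrightarrow> B (r n) y \<le> a n" "a \<longlonglongrightarrow> c" for y r a c N
  proof -
    have "ereal (b y) \<le> liminf ((\<lambda>n. ereal (B n y)) \<circ> r)"
      using liminf_subseq_mono[OF that(1), of "\<lambda>n. ereal (B n y)"] L[of y] by (simp add: L_def)
    also have "\<dots> \<le> liminf (\<lambda>n. ereal (a n))"
      by (intro Liminf_mono eventually_sequentiallyI[of N]) (use that(2) in auto)
    also have "\<dots> = ereal c" using that(3) by (intro lim_imp_Liminf) auto
    finally show ?thesis by simp
  qed
  have 1: "b y \<le> b z + dist y z" for y z
  proof -
    obtain r where r: "strict_mono r" "(\<lambda>n. B (r n) z) \<longlonglongrightarrow> b z" using sub by blast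
    have "(\<lambda>n. B (r n) z + dist y z) \<longlonglongrightarrow> b z + dist y z" by (intro tendsto_intros r)
    then show ?thesis using lip by (intro le[OF r(1), of 0]) auto
  qed
  have 2: "\<bar>b y - b z\<bar> \<le> dist y z" for y z
    using 1[of y z] 1[of z y] by (simp add: dist_commute)
  \<comment> \<open>The points at distance 1 from \<open>y\<close> towards \<open>x (r n)\<close>
    lower \<open>B (r n)\<close> by exactly 1. A limit \<open>l\<close> of them has
    \<open>b l \<le> b y - 1\<close> and lies within 1 of \<open>y\<close>, so the Lipschitz bound
    forces both equalities.\<close>
  moreover have "\<exists>z. dist y z = 1 \<and> b z = b y - 1" for y
  proof -
    obtain r where r: "strict_mono r" "(\<lambda>n. B (r n) y) \<longlonglongrightarrow> b y" using sub by blast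
    obtain N where N: "1 + dist o' y \<le> real N" using real_arch_simple by blast
    have far: "1 \<le> dist y (x (r n))" if "N \<le> n" for n
    proof -
      have "real N \<le> real (r n)" using seq_suble[OF r(1), of n] that by simp
      then show ?thesis using x[of "r n"] N dist_triangle[of o' "x (r n)" y] by simp
    qed
    have "\<exists>z. dist y z = 1 \<and> dist z (x (r n)) = dist y (x (r n)) - 1" if "N \<le> n" for n
      using proper_length_space_between[OF ls proper, of 1 y "x (r n)"] far[OF that] by auto
    \<comment> \<open>For \<open>n < N\<close> the target may be too close; \<open>y\<close> itself
      serves as a default there and keeps the whole sequence in the compact ball.\<close>
    then have "\<exists>z. dist y z \<le> 1 \<and> (N \<le> n \<longrightarrow> dist y z = 1 \<and> dist z (x (r n)) = dist y (x (r n)) - 1)" for n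
      by (metis dist_self order_refl zero_le_one)
    then obtain z where z: "\<And>n. dist y (z n) \<le> 1" "\<And>n. N \<le> n \<Longrightarrow> dist y (z n) = 1"
      "\<And>n. N \<le> n \<Longrightarrow> dist (z n) (x (r n)) = dist y (x (r n)) - 1" by metis
    have "z n \<in> cball y 1" for n using z by simp
    then obtain l \<sigma> where l: "strict_mono (\<sigma> :: nat \<Rightarrow> nat)" "(z \<circ> \<sigma>) \<longlonglongrightarrow> l" "l \<in> cball y 1"
      using proper[of y 1] unfolding compact_def by blast
    have "(\<lambda>n. (\<lambda>n. B (r n) y) (\<sigma> n) - 1 + dist l ((z \<circ> \<sigma>) n)) \<longlonglongrightarrow> b y - 1 + dist l l"
      by (intro tendsto_intros l LIMSEQ_subseq_LIMSEQ[OF r(2) l(1), unfolded o_def])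
    moreover have "B (r (\<sigma> n)) l \<le> B (r (\<sigma> n)) y - 1 + dist l (z (\<sigma> n))" if "N \<le> n" for n
    proof -
      have "N \<le> \<sigma> n" using that seq_suble[OF l(1), of n] by simp
      then show ?thesis using lip[of "r (\<sigma> n)" l "z (\<sigma> n)"] z(3)[of "\<sigma> n"] by (simp add: B_def)
    qed
    ultimately have "b l \<le> b y - 1"
      using le[OF strict_mono_o[OF r(1) l(1)], of N l
          "\<lambda>n. B (r (\<sigma> n)) y - 1 + dist l (z (\<sigma> n))" "b y - 1"] by simp
    then show ?thesis using 2[of y l] l(3) by (intro exI[of _ l]) auto
  qed
  ultimately show ?thesis using that by blast
qed


section \<open>Borel measurable selections\<close>

lemma separable_spaceE_sequence:
  assumes "separable_space (euclidean :: 'a::metric_space topology)"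
  obtains q :: "nat \<Rightarrow> 'a::metric_space" where "\<And>x e. 0 < e \<Longrightarrow> \<exists>n. dist x (q n) < e"
proof -
  obtain C :: "'a set" where C: "countable C" "closure C = UNIV"
    using assms unfolding separable_space_def by auto
  then have "C \<noteq> {}" by auto
  then have "range (from_nat_into C) = C" using C by (simp add: range_from_nat_into)
  moreover have "\<exists>c\<in>C. dist c x < e" if "0 < e" for x e
    using C closure_approachable[of x C] that by auto
  ultimately show ?thesis
    by (intro that[of "from_nat_into C"]) (metis dist_commute imageE)
qed

text \<open>Separability is a hypothesis here, not a type class, so the library's results for
  \<open>second_countable_topology\<close> do not apply; the dense sequence \<open>q\<close> replaces a countable base.\<close>

lemma borel_measurable_Pair_dense_sequence:
  fixes f g :: "'b \<Rightarrow> 'a::metric_space" and q :: "nat \<Rightarrow> 'a"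
  assumes q: "\<And>(x::'a) e. 0 < e \<Longrightarrow> \<exists>n. dist x (q n) < e"
    and [measurable]: "f \<in> borel_measurable M" "g \<in> borel_measurable M"
  shows "(\<lambda>x. (f x, g x)) \<in> borel_measurable M"
proof (rule borel_measurableI)
  fix W :: "('a \<times> 'a) set" assume "open W"
  define I where "I = {(i, j, n::nat). ball (q i) (inverse (Suc n)) \<times> ball (q j) (inverse (Suc n)) \<subseteq> W}"
  have W: "W = (\<Union>(i, j, n)\<in>I. ball (q i) (inverse (Suc n)) \<times> ball (q j) (inverse (Suc n)))"
  proof (intro equalityI subsetI)
    fix w assume "w \<in> W"
    obtain x y where w: "w = (x, y)" by (cases w)
    obtain A B where AB: "open A" "open B" "w \<in> A \<times> B" "A \<times> B \<subseteq> W"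
      using \<open>open W\<close> \<open>w \<in> W\<close> open_prod_elim by metis
    obtain d where d: "0 < d" "ball x d \<subseteq> A" "ball y d \<subseteq> B"
    proof -
      obtain d1 d2 where "0 < d1" "ball x d1 \<subseteq> A" "0 < d2" "ball y d2 \<subseteq> B"
        using AB w by (metis mem_Sigma_iff open_contains_ball)
      then show ?thesis by (intro that[of "min d1 d2"]) auto
    qed
    \<comment> \<open>A ball of radius below \<open>d/2\<close> that contains \<open>x\<close> lies
      inside \<open>ball x d\<close>.\<close>
    obtain n where n: "inverse (real (Suc n)) < d / 2"
      using reals_Archimedean[of "d/2"] d by auto
    obtain i j where ij: "dist x (q i) < inverse (real (Suc n))" "dist y (q j) < inverse (real (Suc n))"
      using q[of "inverse (real (Suc n))" x] q[of "inverse (real (Suc n))" y] by auto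
    have "ball (q i) (inverse (Suc n)) \<subseteq> ball x d"
    proof
      fix z assume "z \<in> ball (q i) (inverse (Suc n))"
      then show "z \<in> ball x d" using n ij dist_triangle[of x z "q i"] by simp
    qed
    moreover have "ball (q j) (inverse (Suc n)) \<subseteq> ball y d"
    proof
      fix z assume "z \<in> ball (q j) (inverse (Suc n))"
      then show "z \<in> ball y d" using n ij dist_triangle[of y z "q j"] by simp
    qed
    ultimately have "(i, j, n) \<in> I" unfolding I_def using d AB by blast
    moreover have "w \<in> ball (q i) (inverse (Suc n)) \<times> ball (q j) (inverse (Suc n))"
      using ij w by (simp add: dist_commute)
    ultimately show "w \<in> (\<Union>(i, j, n)\<in>I. ball (q i) (inverse (Suc n)) \<times> ball (q j) (inverse (Suc n)))"
      by blast
  qed (auto simp: I_def)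
  have "(\<lambda>x. (f x, g x)) -` W \<inter> space M =
      (\<Union>(i, j, n)\<in>I. (f -` ball (q i) (inverse (Suc n)) \<inter> space M) \<inter> (g -` ball (q j) (inverse (Suc n)) \<inter> space M))"
    by (subst W) auto
  moreover have "f -` ball a r \<inter> space M \<in> sets M" "g -` ball a r \<inter> space M \<in> sets M" for a r
    by (auto intro!: measurable_sets[of _ _ borel])
  ultimately show "(\<lambda>x. (f x, g x)) -` W \<inter> space M \<in> sets M"
    by (auto intro!: sets.countable_UN'')
qed

lemma Cauchy_of_dist_le_geometric:
  fixes u :: "nat \<Rightarrow> 'a::metric_space"
  assumes "\<And>n. dist (u n) (u (Suc n)) \<le> c * (1/2)^n"
  shows "Cauchy u"
proof (rule metric_CauchyI)
  fix e :: real assume "0 < e"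
  have "0 \<le> c" using order_trans[OF zero_le_dist assms[of 0]] by simp
  obtain N where "(1/2::real)^N < e / (4 * (c + 1))"
    using real_arch_pow_inv[of "e / (4 * (c + 1))" "1/2"] \<open>0 < e\<close> \<open>0 \<le> c\<close> by auto
  then have "(c + 1) * (1/2::real)^N < e / 4"
    using \<open>0 \<le> c\<close> by (simp add: field_simps)
  moreover have "2 * c * (1/2)^N \<le> 2 * ((c + 1) * (1/2::real)^N)" by (simp add: algebra_simps)
  ultimately have N: "2 * c * (1/2)^N < e / 2" by linarith
  \<comment> \<open>The factor \<open>1 - (1/2)^k\<close> is the exact geometric partial sum;
    without it the induction would not close.\<close>
  have *: "dist (u N) (u (N + k)) \<le> 2 * c * (1/2)^N * (1 - (1/2)^k)" for k
  proof (induction k)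
    case (Suc k)
    have "dist (u (N + k)) (u (N + Suc k)) \<le> c * (1/2)^N * (1/2)^k"
      using assms[of "N + k"] by (simp add: power_add)
    with Suc show ?case
      using dist_triangle[of "u N" "u (N + Suc k)" "u (N + k)"] by (simp add: algebra_simps)
  qed simp
  have near: "dist (u N) (u m) < e/2" if "N \<le> m" for m
  proof -
    have "2 * c * (1/2::real)^N * (1 - (1/2)^(m - N)) \<le> 2 * c * (1/2)^N * 1"
      using \<open>0 \<le> c\<close> by (intro mult_left_mono) auto
    also have "\<dots> < e / 2" using N by simp
    finally have "2 * c * (1/2::real)^N * (1 - (1/2)^(m - N)) < e / 2" .
    from order.strict_trans1[OF *[of "m - N"] this] show ?thesis using that by simp
  qed
  show "\<exists>N. \<forall>m\<ge>N. \<forall>n\<ge>N. dist (u m) (u n) < e"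
  proof (intro exI allI impI)
    fix m n assume "N \<le> m" "N \<le> n"
    then show "dist (u m) (u n) < e"
      using near[of m] near[of n] dist_triangle3[of "u m" "u n" "u N"] by simp
  qed
qed

text \<open>The selection is a limit of countably valued functions \<open>q (I n x)\<close>, each
  within \<open>(1/2)^n\<close> of \<open>S x\<close>. Closedness of \<open>S x\<close> puts the
  limit inside it.\<close>

theorem Kuratowski_Ryll_Nardzewski_selection:
  fixes S :: "'b \<Rightarrow> 'a::complete_space set" and q :: "nat \<Rightarrow> 'a"
  assumes q: "\<And>(x::'a) e. 0 < e \<Longrightarrow> \<exists>n. dist x (q n) < e"
    and cl: "\<And>x. x \<in> space M \<Longrightarrow> closed (S x)" and ne: "\<And>x. x \<in> space M \<Longrightarrow> S x \<noteq> {}"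
    and meas: "\<And>a r. {x \<in> space M. S x \<inter> cball a r \<noteq> {}} \<in> sets M"
  shows "\<exists>f\<in>borel_measurable M. \<forall>x\<in>space M. f x \<in> S x"
proof -
  define H where "H i n x \<longleftrightarrow> S x \<inter> ball (q i) ((1/2)^n) \<noteq> {}" for i n x
  \<comment> \<open>Always taking the least admissible index makes each \<open>I n\<close>
    measurable, as it is determined by countably many measurable predicates.\<close>
  define I where "I = rec_nat (\<lambda>x. LEAST i. H i 0 x)
    (\<lambda>n In x. LEAST i. H i (Suc n) x \<and> dist (q (In x)) (q i) < 2 * (1/2)^n)"
  have I0: "I 0 = (\<lambda>x. LEAST i. H i 0 x)"
    and IS: "I (Suc n) = (\<lambda>x. LEAST i. H i (Suc n) x \<and> dist (q (I n x)) (q i) < 2 * (1/2)^n)" for n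
    by (auto simp: I_def)
  \<comment> \<open>The hypothesis concerns closed balls, the predicate open ones; an open ball is a
    countable union of concentric closed balls, some possibly empty because their radius is
    negative.\<close>
  have H[measurable]: "Measurable.pred M (H i n)" for i n
  proof -
    have "ball (q i) ((1/2)^n) = (\<Union>m. cball (q i) ((1/2)^n - inverse (real (Suc m))))"
    proof (intro equalityI subsetI)
      fix z assume "z \<in> ball (q i) ((1/2)^n)"
      then obtain m where "inverse (real (Suc m)) < (1/2)^n - dist (q i) z"
        using reals_Archimedean[of "(1/2)^n - dist (q i) z"] by auto
      then have "z \<in> cball (q i) ((1/2)^n - inverse (real (Suc m)))" by simp
      then show "z \<in> (\<Union>m. cball (q i) ((1/2)^n - inverse (real (Suc m))))" by blast
    next
      fix z assume "z \<in> (\<Union>m. cball (q i) ((1/2)^n - inverse (real (Suc m))))"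
      then obtain m where "dist (q i) z \<le> (1/2)^n - inverse (real (Suc m))" by auto
      moreover have "0 < inverse (real (Suc m))" by simp
      ultimately show "z \<in> ball (q i) ((1/2)^n)" by (simp only: mem_ball)
    qed
    then have "{x \<in> space M. H i n x} =
        (\<Union>m. {x \<in> space M. S x \<inter> cball (q i) ((1/2)^n - inverse (real (Suc m))) \<noteq> {}})"
      by (auto simp: H_def)
    also have "\<dots> \<in> sets M" using meas by blast
    finally show ?thesis by (simp add: pred_def)
  qed
  have HI: "H (I n x) n x \<and> dist (q (I n x)) (q (I (Suc n) x)) < 2 * (1/2)^n" if x: "x \<in> space M" for n x
  proof -
    \<comment> \<open>A point \<open>s\<close> of \<open>S x\<close> in the current ball is
      approximated by some \<open>q j\<close> to within \<open>(1/2)^(Suc n)\<close>; the two radii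
      add up to less than \<open>2 * (1/2)^n\<close>.\<close>
    have step: "\<exists>j. H j (Suc n) x \<and> dist (q i) (q j) < 2 * (1/2)^n" if Hi: "H i n x" for i n
    proof -
      obtain s where s: "s \<in> S x" "dist (q i) s < (1/2)^n"
        using Hi unfolding H_def disjoint_iff mem_ball by blast
      obtain j where j: "dist s (q j) < (1/2)^(Suc n)" using q[of "(1/2)^(Suc n)" s] by auto
      then have "H j (Suc n) x" using s by (auto simp: H_def dist_commute)
      moreover have "(1/2)^(Suc n) \<le> (1/2::real)^n" by simp
      then have "dist (q i) (q j) < 2 * (1/2)^n" using s j dist_triangle[of "q i" "q j" s] by linarith
      ultimately show ?thesis by blast
    qed
    have "\<exists>i. H i 0 x"
    proof -
      obtain s where "s \<in> S x" using ne x by blast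
      moreover obtain i where "dist s (q i) < 1" using q[of 1 s] by auto
      ultimately show ?thesis by (auto simp: H_def dist_commute intro!: exI[of _ i])
    qed
    then have "H (I 0 x) 0 x" unfolding I0 by (rule LeastI_ex)
    moreover have next_step: "H (I (Suc n) x) (Suc n) x \<and> dist (q (I n x)) (q (I (Suc n) x)) < 2 * (1/2)^n"
      if "H (I n x) n x" for n
      unfolding IS using LeastI_ex[OF step[OF that]] by blast
    ultimately have "H (I n x) n x" for n by (induction n) blast+
    then show ?thesis using next_step by blast
  qed
  have I[measurable]: "I n \<in> measurable M (count_space UNIV)" for n
  proof (induction n)
    case 0
    then show ?case unfolding I0 by measurable
  next
    case (Suc n)
    note [measurable] = Suc
    have [measurable]: "Measurable.pred M (\<lambda>x. dist (q (I n x)) (q i) < 2 * (1/2)^n)" for i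
      by (rule measurable_compose[OF Suc]) simp
    show ?case unfolding IS by measurable
  qed
  define f where "f x = lim (\<lambda>n. q (I n x))" for x
  have lim: "(\<lambda>n. q (I n x)) \<longlonglongrightarrow> f x" if "x \<in> space M" for x
  proof -
    have "Cauchy (\<lambda>n. q (I n x))"
      using HI[OF that] by (intro Cauchy_of_dist_le_geometric[of _ 2]) (simp add: less_imp_le)
    then show ?thesis unfolding f_def by (simp add: Cauchy_convergent convergent_LIMSEQ_iff[symmetric])
  qed
  show ?thesis
  proof (intro bexI ballI)
    show "f \<in> borel_measurable M"
    proof (rule borel_measurable_LIMSEQ_metric[OF _ lim])
      show "(\<lambda>x. q (I n x)) \<in> borel_measurable M" for n
        by (rule measurable_compose[OF I]) simp
    qed
    fix x assume x: "x \<in> space M"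
    have "\<exists>s\<in>S x. dist (q (I n x)) s < (1/2)^n" for n
      using HI[OF x, of n] unfolding H_def disjoint_iff mem_ball by blast
    then obtain s where s: "\<And>n. s n \<in> S x" "\<And>n. dist (q (I n x)) (s n) < (1/2)^n" by metis
    have "(\<lambda>n. (1/2)^n + dist (q (I n x)) (f x)) \<longlonglongrightarrow> 0 + 0"
      by (intro tendsto_add LIMSEQ_realpow_zero tendsto_dist_iff[THEN iffD1, OF lim[OF x]]) auto
    then have upper: "(\<lambda>n. (1/2)^n + dist (q (I n x)) (f x)) \<longlonglongrightarrow> 0" by simp
    have "(\<lambda>n. dist (s n) (f x)) \<longlonglongrightarrow> 0"
    proof (rule tendsto_sandwich[OF _ _ tendsto_const upper])
      show "\<forall>\<^sub>F n in sequentially. dist (s n) (f x) \<le> (1/2)^n + dist (q (I n x)) (f x)"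
      proof (intro always_eventually allI)
        fix n show "dist (s n) (f x) \<le> (1/2)^n + dist (q (I n x)) (f x)"
          using dist_triangle3[of "s n" "f x" "q (I n x)"] s(2)[of n] by linarith
      qed
    qed auto
    then have "s \<longlonglongrightarrow> f x" by (rule tendsto_dist_iff[THEN iffD2])
    then show "f x \<in> S x" using closed_sequentially[OF cl[OF x] s(1)] by simp
  qed
qed

text \<open>Witnesses in \<open>K\<close> along a convergent sequence have a convergent subsequence,
  and its limit is a witness for the limit point.\<close>

lemma closed_relation_meets_compact:
  fixes R :: "'b::metric_space \<Rightarrow> 'a::metric_space \<Rightarrow> bool"
  assumes cl: "\<And>x y u v. (x \<longlonglongrightarrow> u) \<Longrightarrow> (y \<longlonglongrightarrow> v) \<Longrightarrow> (\<And>n. R (x n) (y n)) \<Longrightarrow> R u v"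
    and K: "compact K"
  shows "closed {x. {y. R x y} \<inter> K \<noteq> {}}"
  unfolding closed_sequential_limits
proof (intro allI impI)
  fix x l assume "(\<forall>n. x n \<in> {x. {y. R x y} \<inter> K \<noteq> {}}) \<and> x \<longlonglongrightarrow> l"
  then have x: "x \<longlonglongrightarrow> l" and "\<forall>n. \<exists>y. R (x n) y \<and> y \<in> K" by auto
  then obtain y where y: "\<And>n. R (x n) (y n)" "\<And>n. y n \<in> K" by metis
  obtain v \<sigma> where "v \<in> K" "strict_mono (\<sigma> :: nat \<Rightarrow> nat)" "(y \<circ> \<sigma>) \<longlonglongrightarrow> v"
    using K y(2) unfolding compact_def by blast
  then show "l \<in> {x. {y. R x y} \<inter> K \<noteq> {}}"
    using cl[OF LIMSEQ_subseq_LIMSEQ[OF x], of \<sigma> "y \<circ> \<sigma>" v] y by auto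
qed

text \<open>With compact balls and a closed relation, the sets whose measurability the selection
  theorem demands are closed.\<close>

lemma proper_borel_selection:
  fixes R :: "'b::metric_space \<Rightarrow> 'a::complete_space \<Rightarrow> bool" and q :: "nat \<Rightarrow> 'a"
  assumes q: "\<And>(x::'a) e. 0 < e \<Longrightarrow> \<exists>n. dist x (q n) < e"
    and proper: "\<And>(x::'a) r. compact (cball x r)"
    and cl: "\<And>x y u v. (x \<longlonglongrightarrow> u) \<Longrightarrow> (y \<longlonglongrightarrow> v) \<Longrightarrow> (\<And>n. R (x n) (y n)) \<Longrightarrow> R u v"
    and ne: "\<And>x. \<exists>y. R x y"
  shows "\<exists>f\<in>borel_measurable borel. \<forall>x. R x (f x)"
proof -
  have "\<exists>f\<in>borel_measurable borel. \<forall>x\<in>space borel. f x \<in> {y. R x y}"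
  proof (rule Kuratowski_Ryll_Nardzewski_selection[OF q])
    show "closed {y. R x y}" for x
      unfolding closed_sequential_limits using cl[OF tendsto_const] by blast
    have "closed {x. {y. R x y} \<inter> cball a r \<noteq> {}}" for a r
      by (rule closed_relation_meets_compact[OF cl proper])
    then show "{x \<in> space borel. {y. R x y} \<inter> cball a r \<noteq> {}} \<in> sets borel" for a r
      by simp
  qed (use ne in auto)
  then show ?thesis by simp
qed


section \<open>Dyadic construction of a Borel family of rays\<close>

text \<open>Index \<open>j\<close> at level \<open>k\<close> stands for the time
  \<open>j / 2^k\<close>: level 0 iterates the unit step \<open>T\<close>, and each refinement keeps
  the old points and inserts midpoints. The map \<open>m\<close> acts on pairs because it will be a
  Borel selection over the product space.\<close>

primrec dyadic_path :: "('a \<Rightarrow> 'a) \<Rightarrow> ('a \<times> 'a \<Rightarrow> 'a) \<Rightarrow> nat \<Rightarrow> nat \<Rightarrow> 'a \<Rightarrow> 'a" where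
  "dyadic_path T m 0 j y = (T ^^ j) y"
| "dyadic_path T m (Suc k) j y =
    (if even j then dyadic_path T m k (j div 2) y
     else m (dyadic_path T m k (j div 2) y, dyadic_path T m k (Suc (j div 2)) y))"

lemma dyadic_path_0: "dyadic_path T m k 0 y = y"
  by (induction k) auto

text \<open>Of two neighbours at level \<open>k + 1\<close>, one is an endpoint and the other the
  midpoint of a step at level \<open>k\<close>, so step lengths halve.\<close>

lemma dyadic_path_dist_Suc:
  fixes T :: "'a::metric_space \<Rightarrow> 'a"
  assumes T: "\<And>y. dist y (T y) \<le> 1"
    and m: "\<And>x y. dist x (m (x, y)) = dist x y / 2" "\<And>x y. dist (m (x, y)) y = dist x y / 2"
  shows "dist (dyadic_path T m k j y) (dyadic_path T m k (Suc j) y) \<le> (1/2)^k"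
proof (induction k arbitrary: j)
  case (Suc k)
  then show ?case by (cases "even j") (auto simp: m field_simps)
qed (simp add: T)

lemma dyadic_path_dist:
  fixes T :: "'a::metric_space \<Rightarrow> 'a"
  assumes T: "\<And>y. dist y (T y) \<le> 1"
    and m: "\<And>x y. dist x (m (x, y)) = dist x y / 2" "\<And>x y. dist (m (x, y)) y = dist x y / 2"
  shows "dist (dyadic_path T m k i y) (dyadic_path T m k j y) \<le> \<bar>real i - real j\<bar> * (1/2)^k"
proof -
  have *: "dist (dyadic_path T m k i y) (dyadic_path T m k (i + n) y) \<le> real n * (1/2)^k" for i n
  proof (induction n)
    case (Suc n)
    then show ?case
      using dyadic_path_dist_Suc[of T m k "i + n" y] T m
        dist_triangle[of "dyadic_path T m k i y" "dyadic_path T m k (i + Suc n) y" "dyadic_path T m k (i + n) y"]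
      by (simp add: algebra_simps)
  qed simp
  show ?thesis
  proof (cases "i \<le> j")
    case True
    then show ?thesis using *[of i "j - i"] by (simp add: of_nat_diff)
  next
    case False
    then show ?thesis using *[of j "i - j"] by (simp add: of_nat_diff dist_commute)
  qed
qed

text \<open>Index \<open>j\<close> at the finer level is either the old point \<open>j div 2\<close>
  or the midpoint of the step starting there. This makes the approximations at a fixed time
  Cauchy.\<close>

lemma dyadic_path_refine:
  fixes T :: "'a::metric_space \<Rightarrow> 'a"
  assumes T: "\<And>y. dist y (T y) \<le> 1"
    and m: "\<And>x y. dist x (m (x, y)) = dist x y / 2" "\<And>x y. dist (m (x, y)) y = dist x y / 2"
  shows "dist (dyadic_path T m k (j div 2) y) (dyadic_path T m (Suc k) j y) \<le> 1/2 * (1/2)^k"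
  using dyadic_path_dist_Suc[OF T m, of k "j div 2" y] by (auto simp: m)

text \<open>Across a step \<open>b\<close> drops by the full \<open>(1/2)^k\<close>. Each half of
  the step has length at most \<open>(1/2)^k / 2\<close>, so the Lipschitz bound forces the drop to
  split evenly at the midpoint.\<close>

lemma dyadic_path_horofunction:
  fixes T :: "'a::metric_space \<Rightarrow> 'a" and b :: "'a \<Rightarrow> real"
  assumes T: "\<And>y. dist y (T y) \<le> 1" "\<And>y. b (T y) = b y - 1"
    and m: "\<And>x y. dist x (m (x, y)) = dist x y / 2" "\<And>x y. dist (m (x, y)) y = dist x y / 2"
    and b: "\<And>x y. \<bar>b x - b y\<bar> \<le> dist x y"
  shows "b (dyadic_path T m k j y) = b y - real j * (1/2)^k"
proof (induction k arbitrary: j)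
  case 0
  show ?case by (induction j) (auto simp: T)
next
  case (Suc k)
  show ?case
  proof (cases "even j")
    case True
    then obtain i where "j = 2 * i" by (rule evenE)
    then show ?thesis using Suc[of i] by simp
  next
    case False
    then obtain i where j: "j = 2 * i + 1" by (rule oddE)
    define x z w where "x = dyadic_path T m k i y" and "z = dyadic_path T m k (Suc i) y" and "w = m (x, z)"
    have "dist x w \<le> (1/2)^k / 2" "dist w z \<le> (1/2)^k / 2"
      using dyadic_path_dist_Suc[OF T(1) m, of k i y] by (simp_all add: m w_def x_def z_def)
    moreover have "b x = b y - real i * (1/2)^k" "b z = b y - real i * (1/2)^k - (1/2)^k"
      using Suc[of i] Suc[of "Suc i"] by (simp_all add: x_def z_def algebra_simps)
    ultimately have "b w = b y - real i * (1/2)^k - (1/2)^k / 2"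
      using b[of x w] b[of w z] by linarith
    moreover have "dyadic_path T m (Suc k) j y = w" by (simp add: j w_def x_def z_def)
    moreover have "real j * (1/2)^Suc k = real i * (1/2)^k + (1/2)^k / 2"
      by (simp add: j distrib_right add_divide_distrib)
    ultimately show ?thesis by (simp only: diff_diff_eq)
  qed
qed

lemma dyadic_path_measurable:
  fixes T :: "'a::metric_space \<Rightarrow> 'a" and q :: "nat \<Rightarrow> 'a"
  assumes q: "\<And>(x::'a) e. 0 < e \<Longrightarrow> \<exists>n. dist x (q n) < e"
    and T: "T \<in> borel_measurable borel" and m: "m \<in> borel_measurable borel"
  shows "dyadic_path T m k j \<in> borel_measurable borel"
proof (induction k arbitrary: j)
  case 0
  have "T ^^ j \<in> borel_measurable borel"
    by (induction j) (auto simp: comp_def id_def intro: measurable_compose[OF _ T])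
  moreover have "dyadic_path T m 0 j = T ^^ j" by auto
  ultimately show ?case by simp
next
  case (Suc k)
  show ?case
  proof (cases "even j")
    case True
    then have "dyadic_path T m (Suc k) j = dyadic_path T m k (j div 2)" by auto
    then show ?thesis using Suc by simp
  next
    case False
    then have "dyadic_path T m (Suc k) j =
      (\<lambda>y. m (dyadic_path T m k (j div 2) y, dyadic_path T m k (Suc (j div 2)) y))" by auto
    then show ?thesis
      using measurable_compose[OF borel_measurable_Pair_dense_sequence[OF q Suc Suc] m] by simp
  qed
qed

text \<open>Rounding a time down to the grid of level \<open>k + 1\<close> and halving the index
  gives its rounding at level \<open>k\<close>, which is the form that
  \<open>dyadic_path_refine\<close> takes.\<close>

lemma nat_floor_double_div_2: "nat \<lfloor>2 * x\<rfloor> div 2 = nat \<lfloor>x\<rfloor>" for x :: real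
proof -
  have "\<lfloor>2 * x\<rfloor> div 2 = \<lfloor>x\<rfloor>" by linarith
  then show ?thesis by (metis nat_div_distrib' nat_numeral zero_le_numeral)
qed

lemma dyadic_floor_tendsto:
  assumes "0 \<le> t"
  shows "(\<lambda>k. real (nat \<lfloor>t * 2^k\<rfloor>) * (1/2)^k) \<longlonglongrightarrow> t"
proof (rule tendsto_sandwich[of "\<lambda>k. t - (1/2)^k" _ _ "\<lambda>_. t"])
  have "t - (1/2)^k \<le> real (nat \<lfloor>t * 2^k\<rfloor>) * (1/2)^k" for k
  proof -
    have "(t * 2^k - 1) * (1/2)^k \<le> real (nat \<lfloor>t * 2^k\<rfloor>) * (1/2)^k"
      by (intro mult_right_mono) (linarith, simp)
    then show ?thesis by (simp add: algebra_simps power_one_over)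
  qed
  then show "\<forall>\<^sub>F k in sequentially. t - (1/2)^k \<le> real (nat \<lfloor>t * 2^k\<rfloor>) * (1/2)^k" by simp
  have "real (nat \<lfloor>t * 2^k\<rfloor>) * (1/2)^k \<le> t" for k
  proof -
    have "real (nat \<lfloor>t * 2^k\<rfloor>) * (1/2)^k \<le> t * 2^k * (1/2)^k"
      using assms by (intro mult_right_mono of_nat_floor) auto
    then show ?thesis by (simp add: power_one_over)
  qed
  then show "\<forall>\<^sub>F k in sequentially. real (nat \<lfloor>t * 2^k\<rfloor>) * (1/2)^k \<le> t" by simp
  have "(\<lambda>k. t - (1/2)^k) \<longlonglongrightarrow> t - 0" by (intro tendsto_diff tendsto_const LIMSEQ_realpow_zero) auto
  then show "(\<lambda>k. t - (1/2)^k) \<longlonglongrightarrow> t" by simp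
qed auto

text \<open>The dyadic paths of Borel selections \<open>T\<close> and \<open>m\<close> converge at
  every time. Only the upper bound on distances is recorded; the exact drop of the 1-Lipschitz
  \<open>b\<close> yields the reverse inequality.\<close>

theorem measurable_ray_field_exists:
  fixes b :: "'a::complete_space \<Rightarrow> real" and q :: "nat \<Rightarrow> 'a"
  assumes q: "\<And>(x::'a) e. 0 < e \<Longrightarrow> \<exists>n. dist x (q n) < e"
    and ls: "length_space TYPE('a)" and proper: "\<And>(x::'a) r. compact (cball x r)"
    and b: "\<And>x y. \<bar>b x - b y\<bar> \<le> dist x y" and step: "\<And>y. \<exists>z. dist y z = 1 \<and> b z = b y - 1"
  obtains \<Gamma> :: "real \<Rightarrow> 'a \<Rightarrow> 'a" where
    "\<And>t. \<Gamma> t \<in> borel_measurable borel" "\<And>y. \<Gamma> 0 y = y"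
    "\<And>s t y. 0 \<le> s \<Longrightarrow> 0 \<le> t \<Longrightarrow> dist (\<Gamma> s y) (\<Gamma> t y) \<le> \<bar>s - t\<bar>"
    "\<And>t y. 0 \<le> t \<Longrightarrow> b (\<Gamma> t y) = b y - t"
proof -
  have b_lim: "(\<lambda>n. b (x n)) \<longlonglongrightarrow> b u" if "x \<longlonglongrightarrow> u" for x u
  proof (rule tendsto_dist_iff[THEN iffD2], rule tendsto_sandwich[OF _ _ tendsto_const])
    show "(\<lambda>n. dist (x n) u) \<longlonglongrightarrow> 0" by (rule tendsto_dist_iff[THEN iffD1, OF that])
  qed (auto simp: dist_real_def b)
  have "\<exists>T\<in>borel_measurable borel. \<forall>y. dist y (T y) = 1 \<and> b (T y) = b y - 1"
  proof (rule proper_borel_selection[OF q proper, of "\<lambda>y z. dist y z = 1 \<and> b z = b y - 1"])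
    fix x y :: "nat \<Rightarrow> 'a" and u v
    assume lim: "x \<longlonglongrightarrow> u" "y \<longlonglongrightarrow> v" and R: "\<And>n. dist (x n) (y n) = 1 \<and> b (y n) = b (x n) - 1"
    have "(\<lambda>n. dist (x n) (y n)) \<longlonglongrightarrow> dist u v" by (intro tendsto_intros lim)
    moreover have "(\<lambda>n. b (x n) - 1) \<longlonglongrightarrow> b u - 1" by (intro tendsto_intros b_lim lim)
    moreover have "(\<lambda>n. b (x n) - 1) \<longlonglongrightarrow> b v" using b_lim[OF lim(2)] R by simp
    ultimately show "dist u v = 1 \<and> b v = b u - 1"
      using R LIMSEQ_unique[of "\<lambda>n. b (x n) - 1" "b v" "b u - 1"] by (simp add: LIMSEQ_const_iff)
  qed (use step in auto)
  then obtain T where T: "T \<in> borel_measurable borel" "\<And>y. dist y (T y) = 1 \<and> b (T y) = b y - 1"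
    by blast
  define mid where "mid z w \<longleftrightarrow>
    dist (fst z) w = dist (fst z) (snd z) / 2 \<and> dist w (snd z) = dist (fst z) (snd z) / 2" for z :: "'a \<times> 'a" and w :: 'a
  have mid_closed: "mid u v"
    if lim: "x \<longlonglongrightarrow> u" "y \<longlonglongrightarrow> v" and x: "\<And>n. mid (x n) (y n)" for x y u v
  proof -
    have half: "(\<lambda>n. dist (fst (x n)) (snd (x n)) / 2) \<longlonglongrightarrow> dist (fst u) (snd u) / 2"
      by (intro tendsto_intros lim) simp
    have "(\<lambda>n. dist (fst (x n)) (y n)) \<longlonglongrightarrow> dist (fst u) v"
      "(\<lambda>n. dist (y n) (snd (x n))) \<longlonglongrightarrow> dist v (snd u)" by (intro tendsto_intros lim)+
    then have "(\<lambda>n. dist (fst (x n)) (snd (x n)) / 2) \<longlonglongrightarrow> dist (fst u) v"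
      "(\<lambda>n. dist (fst (x n)) (snd (x n)) / 2) \<longlonglongrightarrow> dist v (snd u)"
      unfolding x[unfolded mid_def, THEN conjunct1] x[unfolded mid_def, THEN conjunct2] .
    then show ?thesis unfolding mid_def using LIMSEQ_unique[OF _ half] by blast
  qed
  have mid_ex: "\<exists>w. mid z w" for z
    unfolding mid_def
    by (rule proper_length_space_between[OF ls proper, of "dist (fst z) (snd z) / 2" "fst z" "snd z"]) auto
  have "\<exists>m\<in>borel_measurable borel. \<forall>z. mid z (m z)"
    by (rule proper_borel_selection[OF q proper mid_closed mid_ex])
  then obtain m where m: "m \<in> borel_measurable borel" "\<And>z. mid z (m z)" by blast
  have T1: "dist y (T y) \<le> 1" and T2: "b (T y) = b y - 1" for y using T(2) by auto
  have m1: "dist x (m (x, y)) = dist x y / 2" and m2: "dist (m (x, y)) y = dist x y / 2" for x y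
    using m(2)[of "(x, y)"] by (auto simp: mid_def)
  \<comment> \<open>\<open>J k t\<close> is the index of the last grid time up to \<open>t\<close>.
    For negative \<open>t\<close> it is 0, so \<open>\<Gamma> t\<close> is then the identity and
    convergence holds for all \<open>t\<close>.\<close>
  define J where "J k t = nat \<lfloor>t * 2^k\<rfloor>" for k and t :: real
  have J: "(\<lambda>k. real (J k t) * (1/2)^k) \<longlonglongrightarrow> t" if "0 \<le> t" for t
    unfolding J_def by (rule dyadic_floor_tendsto[OF that])
  have J2: "J (Suc k) t div 2 = J k t" for k t
    using nat_floor_double_div_2[of "t * 2^k"] by (simp add: J_def mult_ac)
  define P where "P k t = dyadic_path T m k (J k t)" for k t
  define \<Gamma> where "\<Gamma> t y = lim (\<lambda>k. P k t y)" for t y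
  have lim: "(\<lambda>k. P k t y) \<longlonglongrightarrow> \<Gamma> t y" for t y
  proof -
    have "Cauchy (\<lambda>k. P k t y)"
    proof (rule Cauchy_of_dist_le_geometric)
      show "dist (P k t y) (P (Suc k) t y) \<le> 1/2 * (1/2)^k" for k
        using dyadic_path_refine[OF T1 m1 m2, of k "J (Suc k) t" y] unfolding J2 P_def .
    qed
    then show ?thesis unfolding \<Gamma>_def by (simp add: Cauchy_convergent convergent_LIMSEQ_iff[symmetric])
  qed
  show ?thesis
  proof
    show "\<Gamma> t \<in> borel_measurable borel" for t
      by (rule borel_measurable_LIMSEQ_metric[OF _ lim])
         (simp add: P_def dyadic_path_measurable[OF q T(1) m(1)])
    show "\<Gamma> 0 y = y" for y
      using lim[of 0 y] by (simp add: P_def J_def dyadic_path_0 LIMSEQ_const_iff)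
  next
    fix s t :: real and y assume st: "0 \<le> s" "0 \<le> t"
    have left: "(\<lambda>k. dist (P k s y) (P k t y)) \<longlonglongrightarrow> dist (\<Gamma> s y) (\<Gamma> t y)"
      by (intro tendsto_intros lim)
    have right: "(\<lambda>k. \<bar>real (J k s) * (1/2)^k - real (J k t) * (1/2)^k\<bar>) \<longlonglongrightarrow> \<bar>s - t\<bar>"
      by (intro tendsto_intros J st)
    have "dist (P k s y) (P k t y) \<le> \<bar>real (J k s) * (1/2)^k - real (J k t) * (1/2)^k\<bar>" for k
      using dyadic_path_dist[OF T1 m1 m2, of k "J k s" y "J k t"]
      by (simp add: P_def left_diff_distrib[symmetric] abs_mult)
    then show "dist (\<Gamma> s y) (\<Gamma> t y) \<le> \<bar>s - t\<bar>" by (intro LIMSEQ_le[OF left right]) blast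
  next
    fix t :: real and y assume t: "0 \<le> t"
    have "(\<lambda>k. b y - real (J k t) * (1/2)^k) \<longlonglongrightarrow> b y - t" by (intro tendsto_intros J t)
    moreover have "b (P k t y) = b y - real (J k t) * (1/2)^k" for k
      unfolding P_def by (rule dyadic_path_horofunction[OF T1 T2 m1 m2 b])
    ultimately show "b (\<Gamma> t y) = b y - t" using b_lim[OF lim, of t y] LIMSEQ_unique by force
  qed
qed


section \<open>Moments and transport cost\<close>

lemma powr_add_le:
  fixes u v p :: real
  assumes "0 \<le> u" "0 \<le> v" "0 \<le> p"
  shows "(u + v) powr p \<le> 2 powr p * (u powr p + v powr p)"
proof -
  have "(u + v) powr p \<le> (2 * max u v) powr p" using assms by (intro powr_mono2) auto
  also have "\<dots> = 2 powr p * max u v powr p" using assms by (simp add: powr_mult)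
  also have "\<dots> \<le> 2 powr p * (u powr p + v powr p)"
    by (intro mult_left_mono) (auto simp: max_def)
  finally show ?thesis .
qed

text \<open>This tangent line bound is Young's inequality for \<open>u\<close> and
  \<open>a powr (p - 1)\<close> with the conjugate exponents \<open>p\<close> and
  \<open>p / (p - 1)\<close>.\<close>

lemma powr_tangent_le:
  fixes u a p :: real
  assumes "0 \<le> u" "0 \<le> a" "1 < p"
  shows "a powr p + p * a powr (p - 1) * (u - a) \<le> u powr p"
proof -
  have "u * a powr (p - 1) \<le> u powr p / p + (a powr (p - 1)) powr (p / (p - 1)) / (p / (p - 1))"
    using assms by (intro Youngs_inequality) (auto simp: field_simps)
  also have "(a powr (p - 1)) powr (p / (p - 1)) = a powr p" using assms by (simp add: powr_powr)
  finally have "p * (u * a powr (p - 1)) \<le> u powr p + (p - 1) * a powr p"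
    using assms by (simp add: field_simps)
  moreover have "a powr (p - 1) * a = a powr p"
    using assms by (cases "a = 0") (simp_all add: powr_diff)
  ultimately show ?thesis by (simp add: algebra_simps)
qed

text \<open>Changing the base point alters distances by at most the constant
  \<open>dist a x0\<close>, which has a finite moment under a probability measure.\<close>

lemma Pp_moment_finite:
  fixes \<mu> :: "'a::metric_space measure"
  assumes "\<mu> \<in> Pp p" "0 \<le> p"
  shows "(\<integral>\<^sup>+ x. ennreal (dist a x powr p) \<partial>\<mu>) < \<infinity>"
proof -
  from assms(1) obtain x0 where \<mu>: "sets \<mu> = sets borel" "prob_space \<mu>"
    and fin: "(\<integral>\<^sup>+ x. ennreal (dist x0 x powr p) \<partial>\<mu>) < \<infinity>" by (auto simp: Pp_def)
  interpret prob_space \<mu> by fact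
  have D: "(\<lambda>x. ennreal (dist x0 x powr p)) \<in> borel_measurable \<mu>"
    unfolding measurable_cong_sets[OF \<mu>(1) refl]
    by (intro measurable_compose[OF _ measurable_ennreal] powr_real_measurable borel_measurable_const
        borel_measurable_continuous_onI continuous_intros)
  have "dist a x powr p \<le> 2 powr p * (dist x0 x powr p + dist a x0 powr p)" for x
  proof -
    have "dist a x powr p \<le> (dist x0 x + dist a x0) powr p"
      using dist_triangle[of a x x0] assms(2) by (intro powr_mono2) auto
    also have "\<dots> \<le> 2 powr p * (dist x0 x powr p + dist a x0 powr p)"
      using assms(2) by (intro powr_add_le) auto
    finally show ?thesis .
  qed
  then have "(\<integral>\<^sup>+ x. ennreal (dist a x powr p) \<partial>\<mu>)
      \<le> (\<integral>\<^sup>+ x. ennreal (2 powr p) * (ennreal (dist x0 x powr p) + ennreal (dist a x0 powr p)) \<partial>\<mu>)"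
    by (intro nn_integral_mono)
       (simp flip: ennreal_plus ennreal_mult add: ennreal_leI)
  also have "\<dots> = ennreal (2 powr p) * ((\<integral>\<^sup>+ x. ennreal (dist x0 x powr p) \<partial>\<mu>) + ennreal (dist a x0 powr p))"
    by (simp add: nn_integral_cmult nn_integral_add[OF D] borel_measurable_add[OF D] emeasure_space_1)
  also have "\<dots> < \<infinity>" using fin by (simp add: ennreal_mult_less_top)
  finally show ?thesis .
qed

lemma Pp_distr:
  fixes \<mu> :: "'a::metric_space measure"
  assumes "\<mu> \<in> Pp p" "0 \<le> p" and f: "f \<in> borel_measurable borel" and c: "\<And>x. dist x (f x) \<le> c"
  shows "distr \<mu> borel f \<in> Pp p"
proof -
  have \<mu>: "sets \<mu> = sets borel" "prob_space \<mu>" using assms(1) by (auto simp: Pp_def)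
  interpret prob_space \<mu> by fact
  have f': "f \<in> borel_measurable \<mu>" using f unfolding measurable_cong_sets[OF \<mu>(1) refl] .
  fix a :: 'a
  have D: "(\<lambda>x. ennreal (dist a x powr p)) \<in> borel_measurable borel"
    by (intro measurable_compose[OF _ measurable_ennreal] powr_real_measurable borel_measurable_const
        borel_measurable_continuous_onI continuous_intros)
  then have D': "(\<lambda>x. ennreal (dist a x powr p)) \<in> borel_measurable \<mu>"
    unfolding measurable_cong_sets[OF \<mu>(1) refl] .
  have "0 \<le> c" using order_trans[OF zero_le_dist c] .
  have "dist a (f x) powr p \<le> 2 powr p * (dist a x powr p + c powr p)" for x
  proof -
    have "dist a (f x) powr p \<le> (dist a x + c) powr p"
      using dist_triangle[of a "f x" x] c[of x] assms(2) by (intro powr_mono2) auto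
    also have "\<dots> \<le> 2 powr p * (dist a x powr p + c powr p)"
      using assms(2) \<open>0 \<le> c\<close> by (intro powr_add_le) auto
    finally show ?thesis .
  qed
  then have "(\<integral>\<^sup>+ x. ennreal (dist a (f x) powr p) \<partial>\<mu>)
      \<le> (\<integral>\<^sup>+ x. ennreal (2 powr p) * (ennreal (dist a x powr p) + ennreal (c powr p)) \<partial>\<mu>)"
    by (intro nn_integral_mono) (simp flip: ennreal_plus ennreal_mult add: ennreal_leI)
  also have "\<dots> = ennreal (2 powr p) * ((\<integral>\<^sup>+ x. ennreal (dist a x powr p) \<partial>\<mu>) + ennreal (c powr p))"
    by (simp add: nn_integral_cmult nn_integral_add[OF D'] borel_measurable_add[OF D'] emeasure_space_1)
  also have "\<dots> < \<infinity>"
    using Pp_moment_finite[OF assms(1,2), of a] by (simp add: ennreal_mult_less_top)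
  finally have "(\<integral>\<^sup>+ x. ennreal (dist a x powr p) \<partial>distr \<mu> borel f) < \<infinity>"
    by (subst nn_integral_distr[OF f']) (simp_all add: D)
  then show ?thesis using prob_space_distr[OF f'] by (auto simp: Pp_def)
qed

text \<open>Such a \<open>b\<close> grows at most like the distance, and a distance is at most 1
  plus its \<open>p\<close>-th power.\<close>

lemma Pp_integrable_lipschitz:
  fixes \<mu> :: "'a::metric_space measure" and b :: "'a \<Rightarrow> real"
  assumes "\<mu> \<in> Pp p" "1 \<le> p" and b: "\<And>x y. \<bar>b x - b y\<bar> \<le> dist x y"
    and b_meas: "b \<in> borel_measurable borel"
  shows "integrable \<mu> b"
proof -
  have \<mu>: "sets \<mu> = sets borel" "prob_space \<mu>" using assms(1) by (auto simp: Pp_def)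
  interpret prob_space \<mu> by fact
  fix a :: 'a
  have D: "(\<lambda>x. dist a x powr p) \<in> borel_measurable \<mu>"
    unfolding measurable_cong_sets[OF \<mu>(1) refl]
    by (intro powr_real_measurable borel_measurable_const borel_measurable_continuous_onI continuous_intros)
  have "integrable \<mu> (\<lambda>x. dist a x powr p)"
    using Pp_moment_finite[OF assms(1), of a] assms(2) D by (intro integrableI_bounded) auto
  then have int: "integrable \<mu> (\<lambda>x. \<bar>b a\<bar> + 1 + dist a x powr p)" by simp
  show ?thesis
  proof (rule Bochner_Integration.integrable_bound[OF int])
    show "b \<in> borel_measurable \<mu>" using b_meas unfolding measurable_cong_sets[OF \<mu>(1) refl] .
    have "\<bar>b x\<bar> \<le> \<bar>\<bar>b a\<bar> + 1 + dist a x powr p\<bar>" for x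
    proof -
      have "dist a x \<le> 1 + dist a x powr p"
      proof (cases "dist a x \<le> 1")
        case True
        then show ?thesis using powr_ge_zero[of "dist a x" p] by linarith
      next
        case False
        then have "dist a x powr 1 \<le> dist a x powr p" using assms(2) by (intro powr_mono) auto
        then show ?thesis using False by simp
      qed
      then show ?thesis using b[of x a] powr_ge_zero[of "dist a x" p] by (simp add: dist_commute)
    qed
    then show "AE x in \<mu>. norm (b x) \<le> norm (\<bar>b a\<bar> + 1 + dist a x powr p)" by simp
  qed
qed

lemma lipschitz_borel_measurable:
  fixes b :: "'a::metric_space \<Rightarrow> real"
  assumes "\<And>x y. \<bar>b x - b y\<bar> \<le> dist x y"
  shows "b \<in> borel_measurable borel"
proof (rule borel_measurable_continuous_onI)
  show "continuous_on UNIV b"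
    unfolding continuous_on_iff dist_real_def using assms by (meson le_less_trans)
qed

text \<open>Integrating the tangent line of \<open>u powr p\<close> at \<open>\<bar>d\<bar>\<close> replaces Jensen's inequality.\<close>

lemma coupling_cost_ge:
  fixes \<mu> \<mu>' :: "'a::metric_space measure" and b :: "'a \<Rightarrow> real"
  assumes "\<mu> \<in> Pp p" "\<mu>' \<in> Pp p" "1 < p" and \<pi>: "\<pi> \<in> couplings \<mu> \<mu>'"
    and b: "\<And>x y. \<bar>b x - b y\<bar> \<le> dist x y"
  shows "ennreal (\<bar>(\<integral>x. b x \<partial>\<mu>) - (\<integral>x. b x \<partial>\<mu>')\<bar> powr p)
      \<le> (\<integral>\<^sup>+ z. ennreal (dist (fst z) (snd z) powr p) \<partial>\<pi>)"
proof (cases "(\<integral>\<^sup>+ z. ennreal (dist (fst z) (snd z) powr p) \<partial>\<pi>) = \<infinity>")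
  case False
  have \<pi>': "sets \<pi> = sets borel" "prob_space \<pi>" "distr \<pi> borel fst = \<mu>" "distr \<pi> borel snd = \<mu>'"
    using \<pi> by (auto simp: couplings_def)
  interpret prob_space \<pi> by fact
  have b_meas: "b \<in> borel_measurable borel" by (rule lipschitz_borel_measurable[OF b])
  have proj: "fst \<in> measurable \<pi> borel" "snd \<in> measurable \<pi> borel"
    unfolding measurable_cong_sets[OF \<pi>'(1) refl]
    by (intro borel_measurable_continuous_onI continuous_intros)+
  have D: "(\<lambda>z. dist (fst z) (snd z) powr p) \<in> borel_measurable \<pi>"
    unfolding measurable_cong_sets[OF \<pi>'(1) refl]
    by (intro powr_real_measurable borel_measurable_const borel_measurable_continuous_onI continuous_intros)
  have int_D: "integrable \<pi> (\<lambda>z. dist (fst z) (snd z) powr p)"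
    using False D by (intro integrableI_bounded) (auto simp: less_top)
  have "integrable \<mu> b" "integrable \<mu>' b"
    using Pp_integrable_lipschitz[OF _ _ b b_meas, of _ p] assms(1-3) by auto
  then have int_b[simp]: "integrable \<pi> (\<lambda>z. b (fst z))" "integrable \<pi> (\<lambda>z. b (snd z))"
    using \<pi>'(3,4) integrable_distr[OF proj(1), of b] integrable_distr[OF proj(2), of b] by auto
  have I: "(\<integral>x. b x \<partial>\<mu>) = (\<integral>z. b (fst z) \<partial>\<pi>)" "(\<integral>x. b x \<partial>\<mu>') = (\<integral>z. b (snd z) \<partial>\<pi>)"
    using integral_distr[OF proj(1) b_meas] integral_distr[OF proj(2) b_meas] \<pi>'(3,4) by auto
  define d where "d = (\<integral>z. b (fst z) \<partial>\<pi>) - (\<integral>z. b (snd z) \<partial>\<pi>)"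
  \<comment> \<open>The factor \<open>sgn d\<close> orients the increment of \<open>b\<close> so
    that its mean is \<open>\<bar>d\<bar>\<close>; the linear term then integrates to 0, while the
    oriented increment stays below the distance.\<close>
  define h where "h z = \<bar>d\<bar> powr p + p * \<bar>d\<bar> powr (p - 1) * (sgn d * (b (fst z) - b (snd z)) - \<bar>d\<bar>)" for z
  have "sgn d * d = \<bar>d\<bar>" by (simp add: abs_sgn mult.commute)
  then have "(\<integral>z. h z \<partial>\<pi>) = \<bar>d\<bar> powr p"
    unfolding h_def by (simp add: prob_space d_def[symmetric])
  moreover have "(\<integral>z. h z \<partial>\<pi>) \<le> (\<integral>z. dist (fst z) (snd z) powr p \<partial>\<pi>)"
  proof (rule integral_mono[OF _ int_D])
    show "integrable \<pi> h" unfolding h_def by simp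
    fix z
    have "sgn d * (b (fst z) - b (snd z)) \<le> dist (fst z) (snd z)"
      using b[of "fst z" "snd z"] by (auto simp: sgn_real_def)
    then have "h z \<le> \<bar>d\<bar> powr p + p * \<bar>d\<bar> powr (p - 1) * (dist (fst z) (snd z) - \<bar>d\<bar>)"
      unfolding h_def using assms(3) by (intro add_left_mono mult_left_mono) auto
    also have "\<dots> \<le> dist (fst z) (snd z) powr p"
      using assms(3) by (intro powr_tangent_le) auto
    finally show "h z \<le> dist (fst z) (snd z) powr p" .
  qed
  ultimately have "ennreal (\<bar>d\<bar> powr p) \<le> ennreal (\<integral>z. dist (fst z) (snd z) powr p \<partial>\<pi>)"
    by (simp add: ennreal_leI)
  also have "\<dots> = (\<integral>\<^sup>+ z. ennreal (dist (fst z) (snd z) powr p) \<partial>\<pi>)"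
    by (rule nn_integral_eq_integral[OF int_D, symmetric]) simp
  finally show ?thesis by (simp add: d_def I)
qed simp

text \<open>One coupling attains the lower bound, so the infimum is finite and
  \<open>enn2real\<close> does not fall back to its value 0 at infinity.\<close>

lemma Wp_eqI:
  assumes "1 < p" "0 \<le> c" and \<pi>: "\<pi> \<in> couplings \<mu> \<mu>'"
    and le: "(\<integral>\<^sup>+ z. ennreal (dist (fst z) (snd z) powr p) \<partial>\<pi>) \<le> ennreal (c powr p)"
    and ge: "\<And>\<pi>. \<pi> \<in> couplings \<mu> \<mu>' \<Longrightarrow>
        ennreal (c powr p) \<le> (\<integral>\<^sup>+ z. ennreal (dist (fst z) (snd z) powr p) \<partial>\<pi>)"
  shows "Wp p \<mu> \<mu>' = c"
proof -
  have "(INF \<pi> \<in> couplings \<mu> \<mu>'. \<integral>\<^sup>+ z. ennreal (dist (fst z) (snd z) powr p) \<partial>\<pi>) = ennreal (c powr p)"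
    by (rule antisym, rule INF_lower2[OF \<pi>], rule le, rule INF_greatest, rule ge)
  then show ?thesis using assms(1,2) by (simp add: Wp_def powr_powr)
qed


section \<open>The ray of pushforward measures\<close>

theorem theorem1p1:
  fixes p :: real and \<nu> :: "'a::complete_space measure"
  assumes "separable_space (euclidean :: 'a topology)"
    and "\<not> compact (UNIV :: 'a set)"
    and "locally_compact_space (euclidean :: 'a topology)"
    and "length_space TYPE('a)"
    and "p > 1"
    and "\<nu> \<in> Pp p"
  shows "\<exists>\<gamma>. Wp_ray p \<gamma> \<and> Wp p (\<gamma> 0) (\<gamma> 1) = 1 \<and> \<gamma> 0 = \<nu>"
proof -
  have proper: "compact (cball x r)" for x :: 'a and r
    by (rule Hopf_Rinow_compact_cball[OF assms(4,3)])
  obtain q :: "nat \<Rightarrow> 'a" where q: "\<And>x e. 0 < e \<Longrightarrow> \<exists>n. dist x (q n) < e"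
    using separable_spaceE_sequence[OF assms(1)] by metis
  obtain b :: "'a \<Rightarrow> real" where b: "\<And>x y. \<bar>b x - b y\<bar> \<le> dist x y"
    and step: "\<And>y. \<exists>z. dist y z = 1 \<and> b z = b y - 1"
    using horofunction_exists[OF assms(4) proper assms(2)] by metis
  obtain \<Gamma> :: "real \<Rightarrow> 'a \<Rightarrow> 'a" where \<Gamma>: "\<And>t. \<Gamma> t \<in> borel_measurable borel" "\<And>y. \<Gamma> 0 y = y"
    and \<Gamma>_dist: "\<And>s t y. 0 \<le> s \<Longrightarrow> 0 \<le> t \<Longrightarrow> dist (\<Gamma> s y) (\<Gamma> t y) \<le> \<bar>s - t\<bar>"
    and \<Gamma>_b: "\<And>t y. 0 \<le> t \<Longrightarrow> b (\<Gamma> t y) = b y - t"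
    by (rule measurable_ray_field_exists[OF q assms(4) proper b step]) (use that in blast)+
  have \<nu>: "sets \<nu> = sets borel" "prob_space \<nu>" using assms(6) by (auto simp: Pp_def)
  interpret prob_space \<nu> by fact
  have \<Gamma>_meas: "\<Gamma> t \<in> borel_measurable \<nu>" for t
    using \<Gamma>(1) unfolding measurable_cong_sets[OF \<nu>(1) refl] .
  define \<gamma> where "\<gamma> t = distr \<nu> borel (\<Gamma> t)" for t
  have in_Pp: "\<gamma> t \<in> Pp p" if "0 \<le> t" for t
    unfolding \<gamma>_def using \<Gamma>_dist[of 0 t] that assms(5)
    by (intro Pp_distr[OF assms(6) _ \<Gamma>(1), of t]) (auto simp: \<Gamma>(2))
  \<comment> \<open>Since \<open>b\<close> drops by exactly \<open>t\<close> along every ray, its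
    mean drops by \<open>t\<close>; this gives the lower bound on every coupling.\<close>
  have b_int: "(\<integral>x. b x \<partial>\<gamma> t) = (\<integral>x. b x \<partial>\<nu>) - t" if "0 \<le> t" for t
  proof -
    have b_meas: "b \<in> borel_measurable borel" by (rule lipschitz_borel_measurable[OF b])
    have "integrable \<nu> b"
      using assms(5) by (intro Pp_integrable_lipschitz[OF assms(6) _ b b_meas]) auto
    then show ?thesis
      by (simp add: \<gamma>_def integral_distr[OF \<Gamma>_meas b_meas] \<Gamma>_b[OF that] prob_space)
  qed
  have W: "Wp p (\<gamma> s) (\<gamma> t) = \<bar>s - t\<bar>" if st: "0 \<le> s" "0 \<le> t" for s t
  proof -
    have pair: "(\<lambda>y. (\<Gamma> s y, \<Gamma> t y)) \<in> borel_measurable \<nu>"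
      by (rule borel_measurable_Pair_dense_sequence[OF q \<Gamma>_meas \<Gamma>_meas])
    have proj: "fst \<in> borel_measurable borel" "snd \<in> borel_measurable borel"
      by (intro borel_measurable_continuous_onI continuous_intros)+
    \<comment> \<open>The competitor for the upper bound keeps each particle on its own ray, moving
      it from time \<open>s\<close> to time \<open>t\<close>.\<close>
    define \<pi> where "\<pi> = distr \<nu> borel (\<lambda>y. (\<Gamma> s y, \<Gamma> t y))"
    show ?thesis
    proof (rule Wp_eqI[OF assms(5)])
      show "\<pi> \<in> couplings (\<gamma> s) (\<gamma> t)"
        using prob_space_distr[OF pair]
        by (simp add: couplings_def \<pi>_def \<gamma>_def distr_distr[OF proj(1) pair] distr_distr[OF proj(2) pair] comp_def)
      have D: "(\<lambda>z::'a \<times> 'a. ennreal (dist (fst z) (snd z) powr p)) \<in> borel_measurable borel"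
        by (intro measurable_compose[OF _ measurable_ennreal] powr_real_measurable
            borel_measurable_const borel_measurable_continuous_onI continuous_intros)
      have "(\<integral>\<^sup>+ z. ennreal (dist (fst z) (snd z) powr p) \<partial>\<pi>)
          = (\<integral>\<^sup>+ y. ennreal (dist (\<Gamma> s y) (\<Gamma> t y) powr p) \<partial>\<nu>)"
        unfolding \<pi>_def by (subst nn_integral_distr[OF pair]) (simp_all add: D)
      also have "\<dots> \<le> (\<integral>\<^sup>+ y. ennreal (\<bar>s - t\<bar> powr p) \<partial>\<nu>)"
        using \<Gamma>_dist[OF st] assms(5) by (intro nn_integral_mono ennreal_leI powr_mono2) auto
      finally show "(\<integral>\<^sup>+ z. ennreal (dist (fst z) (snd z) powr p) \<partial>\<pi>) \<le> ennreal (\<bar>s - t\<bar> powr p)"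
        by (simp add: emeasure_space_1)
      fix \<rho> assume "\<rho> \<in> couplings (\<gamma> s) (\<gamma> t)"
      from coupling_cost_ge[OF in_Pp[OF st(1)] in_Pp[OF st(2)] assms(5) this b]
      show "ennreal (\<bar>s - t\<bar> powr p) \<le> (\<integral>\<^sup>+ z. ennreal (dist (fst z) (snd z) powr p) \<partial>\<rho>)"
        by (simp add: b_int st abs_minus_commute)
    qed simp
  qed
  \<comment> \<open>As the distance between times \<open>s\<close> and \<open>t\<close> is exactly
    \<open>\<bar>s - t\<bar>\<close>, continuity holds with \<delta> equal to
    \<open>e\<close>.\<close>
  have "Wp_ray p \<gamma>"
    unfolding Wp_ray_def using in_Pp by (auto simp: W)
  moreover have "\<gamma> 0 = \<nu>"
  proof -
    have "\<Gamma> 0 = id" using \<Gamma>(2) by auto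
    then show ?thesis using distr_id2[OF \<nu>(1)[symmetric]] by (simp add: \<gamma>_def id_def)
  qed
  ultimately show ?thesis using W[of 0 1] by (intro exI[of _ \<gamma>]) simp
qed

end
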